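(* Let $p$ be a prime, $f\ge 1$ an integer, $q=p^f$, and let $k\ge 1$, $d\ge 1$, $e\ge 0$ be integers. Let $C$ be a $[g_q(k,d),k,d]_q$ Griesmer code. If $q^e\mid d$, then $p^e\mid \mathrm{wt}(c)$ for every codeword $c\in C$.
   Context: An $[n,k,d]_q$ code is a $k$-dimensional $\mathbb{F}_q$-linear subspace of $\mathbb{F}_q^n$ whose minimum Hamming weight of a nonzero codeword is $d$; $\mathrm{wt}(c)$ is the number of nonzero coordinates of $c$. For positive integers $k,d$, $g_q(k,d):=\sum_{i=0}^{k-1}\lceil d/q^i\rceil$. Every $[n,k,d]_q$ code satisfies $n\ge g_q(k,d)$ (Griesmer bound); an $[n,k,d]_q$ code with $n=g_q(k,d)$ is called a Griesmer code. Codes are assumed to have full length (no coordinate at which all codewords vanish). *)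

theory Defs
  imports "HOL-Analysis.Cartesian_Space" "HOL-Computational_Algebra.Primes"
begin

text \<open>The field \<open>\<bbbF>\<^sub>q\<close> is a type \<open>'a :: {field, finite}\<close> with \<open>q = CARD('a)\<close>, and
  \<open>\<bbbF>\<^sub>q\<^sup>n\<close> is \<open>'a ^ 'n\<close> with \<open>n = CARD('n)\<close>. Subspaces and dimensions over
  \<open>'a\<close> are \<open>vec.subspace\<close> and \<open>vec.dim\<close>; the unqualified \<open>subspace\<close> and \<open>dim\<close>
  refer to real vector spaces.\<close>

definition wt :: "'a::{field,finite} ^ 'n \<Rightarrow> nat" where
  "wt c = card {i. c $ i \<noteq> 0}"

text \<open>Only meaningful for \<open>C\<close> with a nonzero element, since \<open>Min {}\<close> is unspecified.\<close>

definition min_weight :: "('a::{field,finite} ^ 'n) set \<Rightarrow> nat" where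
  "min_weight C = Min (wt ` (C - {0}))"

definition linear_code ::
    "nat \<Rightarrow> nat \<Rightarrow> nat \<Rightarrow> nat \<Rightarrow> ('a::{field,finite} ^ 'n) set \<Rightarrow> bool" where
  "linear_code q n k d C \<longleftrightarrow>
     CARD('a) = q \<and> CARD('n) = n \<and>
     vec.subspace C \<and> vec.dim C = k \<and> min_weight C = d"

definition full_length :: "('a::{field,finite} ^ 'n) set \<Rightarrow> bool" where
  "full_length C \<longleftrightarrow> (\<forall>i. \<exists>c\<in>C. c $ i \<noteq> 0)"

definition griesmer_bound :: "nat \<Rightarrow> nat \<Rightarrow> nat \<Rightarrow> nat" where
  "griesmer_bound q k d = (\<Sum>i<k. nat \<lceil>real d / real q ^ i\<rceil>)"

definition griesmer_code ::
    "nat \<Rightarrow> nat \<Rightarrow> nat \<Rightarrow> ('a::{field,finite} ^ 'n) set \<Rightarrow> bool" where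
  "griesmer_code q k d C \<longleftrightarrow> linear_code q (griesmer_bound q k d) k d C"

end

theory Submission
  imports Defs "HOL-Computational_Algebra.Polynomial"
begin

text \<open>The proof is by induction on \<open>k\<close>, for all \<open>d\<close> and \<open>e\<close> simultaneously. For \<open>e > 0\<close> and \<open>k > 1\<close>
  a Griesmer code with \<open>q\<^sup>e\<close> dividing \<open>d\<close> has a two-dimensional subcode \<open>T = \<langle>m, n\<rangle>\<close> all of whose
  nonzero words have weight \<open>d\<close>. The residual code with respect to each of these words is a
  Griesmer code with parameters \<open>k - 1\<close>, \<open>d / q\<close>, so its weights are divisible by \<open>p\<^sup>e\<^sup>-\<^sup>1\<close>.
  Counting coordinates writes \<open>wt (c + y)\<close>, for \<open>y\<close> in \<open>T\<close>, up to a constant as a sum of such residual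
  weights, each of which depends only on \<open>y\<close> modulo a line. Hence \<open>wt (c + y) / p\<^sup>e\<^sup>-\<^sup>1\<close>, read in \<open>\<bbbF>\<^sub>q\<close>,
  is a polynomial function of total degree at most \<open>q - 1\<close> on the plane \<open>T\<close>. On the other hand,
  every direction \<open>t\<close> in \<open>T\<close> lies in a shortened code \<open>U\<close> at a point of maximal multiplicity that
  does not contain \<open>T\<close>. Such a \<open>U\<close> is again a Griesmer code, with parameters \<open>k - 1\<close>, \<open>d\<close>, so by
  induction the polynomial vanishes on a line of direction \<open>t\<close>, namely where \<open>c + y\<close> is in \<open>U\<close>.
  A polynomial of degree less than \<open>q\<close> that vanishes on a line of every slope is zero.\<close>

section \<open>Polynomial functions on the affine plane\<close>

lemma card_field_ge_2: "2 \<le> CARD('a::{field,finite})"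
proof -
  have "card {0, 1 :: 'a} \<le> CARD('a)"
    by (rule card_mono) auto
  then show ?thesis by simp
qed

lemma coeff_linear_power_top: "coeff ([:b, s:] ^ j) j = (s :: 'a::field) ^ j"
proof (induction j)
  case (Suc j)
  have "degree ([:b, s:] ^ j) \<le> j"
    using degree_power_le[of "[:b, s:]" j] by (auto intro: order_trans)
  then have "coeff ([:b, s:] ^ j) (Suc j) = 0"
    by (intro coeff_eq_0) simp
  with Suc show ?case by simp
qed simp

lemma poly_zero_if_vanishing:
  fixes P :: "'a::{field,finite} poly"
  assumes "degree P < CARD('a)" and "\<And>x. poly P x = 0"
  shows "P = 0"
proof (rule ccontr)
  assume "P \<noteq> 0"
  then have "card {x. poly P x = 0} \<le> degree P"
    by (rule card_poly_roots_bound)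
  with assms show False by simp
qed

text \<open>Lagrange interpolation over the whole field: every function is a polynomial of degree
  below \<open>CARD('a)\<close>, small enough for root counting.\<close>

lemma interpolation_exists:
  fixes a :: "'a::{field,finite} \<Rightarrow> 'a"
  shows "\<exists>c. \<forall>x. a x = (\<Sum>n<CARD('a). c n * x ^ n)"
proof -
  define L where "L z = (\<Prod>w\<in>UNIV - {z}. [:- w, 1:])" for z :: 'a
  define P where "P = (\<Sum>z\<in>UNIV. smult (a z / (\<Prod>w\<in>UNIV - {z}. z - w)) (L z))"
  have deg_L: "degree (L z) \<le> CARD('a) - 1" for z
  proof -
    have "degree (L z) \<le> sum (degree \<circ> (\<lambda>w. [:- w, 1:])) (UNIV - {z})"
      unfolding L_def by (rule degree_prod_sum_le) simp
    also have "\<dots> = CARD('a) - 1"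
      by (simp add: card_Diff_singleton)
    finally show ?thesis .
  qed
  have deg_P: "degree P \<le> CARD('a) - 1"
    unfolding P_def by (intro degree_sum_le order_trans[OF degree_smult_le deg_L]) simp
  have "poly P x = a x" for x
  proof -
    have L: "poly (L z) x = (\<Prod>w\<in>UNIV - {z}. x - w)" for z
      by (simp add: L_def poly_prod)
    have "poly (L z) x = 0" if "z \<noteq> x" for z
      unfolding L by (rule prod_zero) (use that in auto)
    then have "poly P x = (\<Sum>z\<in>UNIV. if z = x then a z / (\<Prod>w\<in>UNIV - {z}. z - w) * poly (L z) x else 0)"
      unfolding P_def poly_sum by (intro sum.cong) auto
    also have "\<dots> = a x"
      by (simp add: L)
    finally show ?thesis .
  qed
  moreover have "poly P x = (\<Sum>n<CARD('a). coeff P n * x ^ n)" for x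
  proof -
    have "degree P < CARD('a)"
      using deg_P card_field_ge_2[where 'a='a] by linarith
    then show ?thesis
      unfolding poly_altdef by (intro sum.mono_neutral_left) (auto simp: coeff_eq_0)
  qed
  ultimately show ?thesis
    by (intro exI[of _ "coeff P"]) auto
qed

text \<open>Restricting to a line of slope \<open>s\<close>, the top coefficient is the leading form evaluated
  at \<open>(1, s)\<close>; it vanishes for all \<open>s\<close>, so the leading form is zero and the degree drops.\<close>

lemma bivariate_zero_if_vanishing_on_all_slopes:
  fixes c :: "nat \<Rightarrow> nat \<Rightarrow> 'a::{field,finite}"
  assumes "D \<le> CARD('a)"
    and "\<And>s. \<exists>\<beta>. \<forall>x. (\<Sum>n<D. \<Sum>j\<le>n. c n j * x ^ (n - j) * (s * x + \<beta>) ^ j) = 0"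
  shows "(\<Sum>n<D. \<Sum>j\<le>n. c n j * x ^ (n - j) * y ^ j) = 0"
  using assms
proof (induction D)
  case (Suc D)
  have top: "(\<Sum>j\<le>D. c D j * s ^ j) = 0" for s
  proof -
    obtain \<beta> where \<beta>: "\<And>x. (\<Sum>n<Suc D. \<Sum>j\<le>n. c n j * x ^ (n - j) * (s * x + \<beta>) ^ j) = 0"
      using Suc.prems(2)[of s] by blast
    define T where "T n j = smult (c n j) (monom 1 (n - j) * [:\<beta>, s:] ^ j)" for n j
    \<comment> \<open>\<open>P\<close> is the restriction to the line
      \<open>y = s * x + \<beta>\<close>. Its degree is at most \<open>D < CARD('a)\<close>, so
      vanishing everywhere makes it the zero polynomial.\<close>
    define P where "P = (\<Sum>n<Suc D. \<Sum>j\<le>n. T n j)"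
    have deg_T: "degree (T n j) \<le> n" if "j \<le> n" for n j
    proof -
      have "degree ([:\<beta>, s:] ^ j) \<le> j"
        using degree_power_le[of "[:\<beta>, s:]" j] by (auto intro: order_trans)
      then have "degree (monom 1 (n - j) * [:\<beta>, s:] ^ j) \<le> (n - j) + j"
        by (intro order_trans[OF degree_mult_le] add_mono) (auto simp: degree_monom_eq)
      with that show ?thesis
        unfolding T_def by (intro order_trans[OF degree_smult_le]) simp
    qed
    have "degree P \<le> D"
      unfolding P_def by (intro degree_sum_le) (auto intro: order_trans[OF deg_T])
    moreover have "poly P x = 0" for x
      using \<beta>[of x] by (simp add: P_def T_def poly_sum poly_monom algebra_simps)
    ultimately have "P = 0"
      using Suc.prems(1) by (intro poly_zero_if_vanishing) auto
    moreover have "coeff P D = (\<Sum>j\<le>D. c D j * s ^ j)"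
    proof -
      have "coeff (T n j) D = 0" if "j \<le> n" "n < D" for n j
        using deg_T[OF that(1)] that(2) by (intro coeff_eq_0) simp
      moreover have "coeff (T D j) D = c D j * s ^ j" if "j \<le> D" for j
        using that by (simp add: T_def coeff_monom_mult coeff_linear_power_top)
      ultimately show ?thesis
        by (simp add: P_def coeff_sum)
    qed
    ultimately show ?thesis by simp
  qed
  \<comment> \<open>The leading form at \<open>(1, s)\<close>, as a polynomial in \<open>s\<close>:
    a root at every field element kills all its coefficients.\<close>
  define Q where "Q = (\<Sum>j\<le>D. monom (c D j) j)"
  have "Q = 0"
  proof (rule poly_zero_if_vanishing)
    have "degree Q \<le> D"
      unfolding Q_def by (intro degree_sum_le) (auto intro: order_trans[OF degree_monom_le])
    then show "degree Q < CARD('a)"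
      using Suc.prems(1) by simp
    show "poly Q x = 0" for x
      using top[of x] by (simp add: Q_def poly_sum poly_monom)
  qed
  then have "c D j = 0" if "j \<le> D" for j
  proof -
    have "coeff Q j = c D j"
      using that by (simp add: Q_def coeff_sum)
    with \<open>Q = 0\<close> show ?thesis by simp
  qed
  with Suc show ?case by simp
qed simp

text \<open>\<open>A t\<close> is constant on lines of slope \<open>t\<close>, and \<open>B\<close>
  on vertical lines. Each interpolates to degree below \<open>CARD('a)\<close>, and substituting a
  linear form keeps the total degree below that, so the vanishing criterion for all slopes
  applies.\<close>

lemma sum_of_line_functions_zero:
  fixes A :: "'a::{field,finite} \<Rightarrow> 'a \<Rightarrow> 'a" and B :: "'a \<Rightarrow> 'a"
  assumes "\<And>s. \<exists>\<beta>. \<forall>x. (\<Sum>t\<in>UNIV. A t ((s * x + \<beta>) - t * x)) + B x = 0"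
  shows "(\<Sum>t\<in>UNIV. A t (y - t * x)) + B x = 0"
proof -
  obtain a where a: "\<And>t x. A t x = (\<Sum>n<CARD('a). a t n * x ^ n)"
    using interpolation_exists[of "A t" for t] by metis
  obtain b where b: "\<And>x. B x = (\<Sum>n<CARD('a). b n * x ^ n)"
    using interpolation_exists[of B] by metis
  \<comment> \<open>The coefficient of \<open>x ^ (n - j) * y ^ j\<close> after binomial expansion;
    \<open>B\<close> contributes only pure powers of \<open>x\<close>, hence only to
    \<open>j = 0\<close>.\<close>
  define c where "c n j = (\<Sum>t\<in>UNIV. a t n * of_nat (n choose j) * (- t) ^ (n - j))
    + (if j = 0 then b n else 0)" for n j
  have expand: "(\<Sum>t\<in>UNIV. A t (y - t * x)) + B x
      = (\<Sum>n<CARD('a). \<Sum>j\<le>n. c n j * x ^ (n - j) * y ^ j)" for x y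
  proof -
    have binom: "(y - t * x) ^ n
        = (\<Sum>j\<le>n. of_nat (n choose j) * (- t) ^ (n - j) * x ^ (n - j) * y ^ j)" for t n
    proof -
      have "(y - t * x) ^ n = (\<Sum>j\<le>n. of_nat (n choose j) * y ^ j * ((- t) * x) ^ (n - j))"
        using binomial_ring[of y "(- t) * x" n] by simp
      then show ?thesis
        by (simp only: power_mult_distrib mult_ac)
    qed
    have "(\<Sum>t\<in>UNIV. A t (y - t * x))
        = (\<Sum>t\<in>UNIV. \<Sum>n<CARD('a). \<Sum>j\<le>n. a t n * of_nat (n choose j) * (- t) ^ (n - j) * x ^ (n - j) * y ^ j)"
      by (simp only: a binom sum_distrib_left mult.assoc)
    also have "\<dots> = (\<Sum>n<CARD('a). \<Sum>j\<le>n. \<Sum>t\<in>UNIV. a t n * of_nat (n choose j) * (- t) ^ (n - j) * x ^ (n - j) * y ^ j)"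
      by (subst sum.swap, intro sum.cong refl, subst sum.swap) simp
    finally have 1: "(\<Sum>t\<in>UNIV. A t (y - t * x)) = \<dots>" .
    have 2: "B x = (\<Sum>n<CARD('a). \<Sum>j\<le>n. (if j = 0 then b n else 0) * x ^ (n - j) * y ^ j)"
      unfolding b
    proof (intro sum.cong refl)
      fix n
      have "(\<Sum>j\<le>n. (if j = 0 then b n else 0) * x ^ (n - j) * y ^ j)
          = (\<Sum>j\<le>n. if j = 0 then b n * x ^ n else 0)"
        by (intro sum.cong) auto
      then show "b n * x ^ n = (\<Sum>j\<le>n. (if j = 0 then b n else 0) * x ^ (n - j) * y ^ j)"
        by simp
    qed
    show ?thesis
      unfolding 1 2 c_def by (simp only: sum.distrib[symmetric] distrib_right sum_distrib_right)
  qed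
  show ?thesis
    unfolding expand
  proof (rule bivariate_zero_if_vanishing_on_all_slopes[OF order_refl])
    fix s
    show "\<exists>\<beta>. \<forall>x. (\<Sum>n<CARD('a). \<Sum>j\<le>n. c n j * x ^ (n - j) * (s * x + \<beta>) ^ j) = 0"
      using assms[of s] unfolding expand .
  qed
qed

section \<open>Hyperplanes of subspaces\<close>

lemma dim_span_insert:
  fixes U :: "('a::field ^ 'n) set"
  assumes "vec.subspace U" and "m \<notin> U"
  shows "vec.dim (vec.span (insert m U)) = Suc (vec.dim U)"
  using assms by (simp add: vec.dim_insert vec.span_eq_iff[THEN iffD2])

lemma span_insert_eq:
  fixes U :: "('a::field ^ 'n) set"
  assumes "vec.subspace U" "vec.subspace V" "U \<subseteq> V" "vec.dim V = Suc (vec.dim U)"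
    and "m \<in> V" "m \<notin> U"
  shows "vec.span (insert m U) = V"
proof (rule vec.subspace_dim_equal)
  show "vec.span (insert m U) \<subseteq> V"
    using assms by (intro vec.span_minimal) auto
qed (use assms dim_span_insert[of U m] in simp_all)

text \<open>\<open>U\<close> and \<open>m\<close> together span \<open>V\<close>, so every line of
  direction \<open>m\<close> in \<open>V\<close> meets \<open>U\<close>.\<close>

lemma hyperplane_shift:
  fixes U :: "('a::field ^ 'n) set"
  assumes "vec.subspace U" "vec.subspace V" "U \<subseteq> V" "vec.dim V = Suc (vec.dim U)"
    and "m \<in> V" "m \<notin> U" "x \<in> V"
  obtains l where "x + l *s m \<in> U"
proof -
  have "x \<in> vec.span (insert m U)"
    using span_insert_eq[OF assms(1-6)] assms(7) by simp
  then obtain k where "x - k *s m \<in> vec.span U"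
    using vec.span_breakdown_eq by blast
  then have "x + (- k) *s m \<in> U"
    using assms(1) by (simp add: vec.span_eq_iff[THEN iffD2])
  then show ?thesis by (rule that)
qed

text \<open>Extend a basis of the span of \<open>S\<close>, together with \<open>m\<close>, to a
  basis of \<open>V\<close>; dropping \<open>m\<close> again leaves a basis of the required
  hyperplane.\<close>

lemma hyperplane_avoiding:
  fixes V :: "('a::field ^ 'n) set"
  assumes "vec.subspace V" "S \<subseteq> V" "m \<in> V" "m \<notin> vec.span S"
  obtains W where "vec.subspace W" "S \<subseteq> W" "W \<subseteq> V" "m \<notin> W" "vec.dim V = Suc (vec.dim W)"
proof -
  obtain B where B: "B \<subseteq> S" "vec.independent B" "S \<subseteq> vec.span B" "card B = vec.dim S"
    by (rule vec.basis_exists)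
  have "vec.span B = vec.span S"
    using B by (intro subset_antisym vec.span_mono vec.span_minimal) auto
  then have "vec.independent (insert m B)"
    using B assms by (intro vec.independent_insertI) auto
  moreover have "insert m B \<subseteq> V"
    using B assms by auto
  ultimately obtain B' where B': "insert m B \<subseteq> B'" "B' \<subseteq> V" "vec.independent B'" "V \<subseteq> vec.span B'"
    using vec.maximal_independent_subset_extend[of "insert m B" V] by metis
  define W where "W = vec.span (B' - {m})"
  have ind: "vec.independent (B' - {m})"
    using B'(3) by (rule vec.independent_mono) auto
  have m: "m \<in> B'" "m \<notin> W"
    using B'(1,3) by (auto simp: W_def vec.dependent_def)
  have "B \<noteq> {} \<Longrightarrow> m \<notin> B"
    using assms(4) B vec.span_base by auto
  then have "B \<subseteq> B' - {m}"
    using B'(1) by auto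
  then have "S \<subseteq> W"
    using B(3) unfolding W_def by (meson order_trans vec.span_mono)
  moreover have "W \<subseteq> V"
    unfolding W_def using B'(2) assms(1) by (intro vec.span_minimal) auto
  moreover have "vec.dim V = Suc (vec.dim W)"
  proof -
    have "finite B'"
      using B'(3) by (rule vec.finiteI_independent)
    moreover have "vec.dim V = card B'"
      using vec.basis_card_eq_dim[OF B'(2,4,3)] by simp
    moreover have "vec.dim W = card (B' - {m})"
      unfolding W_def using ind by (rule vec.dim_span_eq_card_independent)
    ultimately show ?thesis
      using m(1) by (simp add: card_Suc_Diff1 del: card_Diff_insert)
  qed
  moreover have "vec.subspace W"
    by (simp add: W_def)
  ultimately show ?thesis
    using that m(2) by blast
qed

section \<open>The Griesmer bound\<close>

definition cdiv :: "nat \<Rightarrow> nat \<Rightarrow> nat" where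
  "cdiv d m = nat \<lceil>real d / real m\<rceil>"

text \<open>The adjunction between rounded-up division and multiplication, from which nesting,
  monotonicity and positivity of \<open>cdiv\<close> follow.\<close>

lemma cdiv_le_iff: "0 < m \<Longrightarrow> cdiv d m \<le> n \<longleftrightarrow> d \<le> n * m"
proof -
  assume "0 < m"
  then have "cdiv d m \<le> n \<longleftrightarrow> real d \<le> real n * real m"
    by (simp add: cdiv_def nat_le_iff ceiling_le_iff pos_divide_le_eq)
  then show ?thesis
    by (simp flip: of_nat_mult)
qed

lemma le_cdiv_mult: "0 < m \<Longrightarrow> d \<le> cdiv d m * m"
  by (simp flip: cdiv_le_iff)

lemma cdiv_cdiv:
  assumes "0 < a" "0 < b"
  shows "cdiv (cdiv d a) b = cdiv d (a * b)"
proof (rule antisym)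
  show "cdiv (cdiv d a) b \<le> cdiv d (a * b)"
    using assms le_cdiv_mult[of "a * b" d] by (simp add: cdiv_le_iff mult_ac)
  show "cdiv d (a * b) \<le> cdiv (cdiv d a) b"
    using assms le_cdiv_mult[of b "cdiv d a"] by (simp add: cdiv_le_iff mult_ac)
qed

lemma cdiv_mono: "0 < m \<Longrightarrow> d \<le> d' \<Longrightarrow> cdiv d m \<le> cdiv d' m"
  using le_cdiv_mult[of m d'] by (simp add: cdiv_le_iff)

lemma cdiv_pos: "0 < m \<Longrightarrow> 0 < d \<Longrightarrow> 0 < cdiv d m"
  using cdiv_le_iff[of m d 0] by (cases "cdiv d m") auto

lemma cdiv_mult_self: "0 < m \<Longrightarrow> cdiv (m * d) m = d"
  by (simp add: cdiv_def)

lemma griesmer_bound_0 [simp]: "griesmer_bound q 0 d = 0"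
  by (simp add: griesmer_bound_def)

lemma griesmer_bound_Suc_last: "griesmer_bound q (Suc k) d = griesmer_bound q k d + cdiv d (q ^ k)"
  by (simp add: griesmer_bound_def cdiv_def)

text \<open>Nested rounding collapses, so the first summand splits off as well as the last.
  Splitting off the first matches residual codes, splitting off the last matches shortening.\<close>

lemma griesmer_bound_Suc:
  assumes "0 < q"
  shows "griesmer_bound q (Suc k) d = d + griesmer_bound q k (cdiv d q)"
proof (induction k)
  case 0
  then show ?case by (simp add: griesmer_bound_def)
next
  case (Suc k)
  have "griesmer_bound q (Suc (Suc k)) d = griesmer_bound q (Suc k) d + cdiv d (q ^ Suc k)"
    by (rule griesmer_bound_Suc_last)
  also have "cdiv d (q ^ Suc k) = cdiv (cdiv d q) (q ^ k)"
    using assms by (simp add: cdiv_cdiv)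
  finally show ?case
    by (simp only: Suc griesmer_bound_Suc_last[of q k "cdiv d q"] add.assoc)
qed

lemma griesmer_bound_mono: "0 < q \<Longrightarrow> d \<le> d' \<Longrightarrow> griesmer_bound q k d \<le> griesmer_bound q k d'"
  by (induction k) (auto simp: griesmer_bound_Suc_last intro!: add_mono cdiv_mono)

section \<open>Weights on a set of coordinates, residual codes and shortened codes\<close>

definition wt_on :: "'n set \<Rightarrow> 'a::{field,finite} ^ 'n \<Rightarrow> nat" where
  "wt_on I c = card {i \<in> I. c $ i \<noteq> 0}"

text \<open>The coordinate set of the residual code with respect to \<open>c\<close>.\<close>

definition zeros :: "'n set \<Rightarrow> 'a::{field,finite} ^ 'n \<Rightarrow> 'n set" where
  "zeros I c = {i \<in> I. c $ i = 0}"

text \<open>For a hyperplane \<open>U\<close> of a code without zero coordinates, these are the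
  coordinates at one projective point, and their number is its multiplicity.\<close>

definition common_zeros :: "'n set \<Rightarrow> ('a::{field,finite} ^ 'n) set \<Rightarrow> 'n set" where
  "common_zeros I U = {i \<in> I. \<forall>x\<in>U. x $ i = 0}"

text \<open>A Griesmer code punctured to the coordinate set \<open>I\<close>; residual and shortened codes are
  obtained by shrinking both \<open>V\<close> and \<open>I\<close>.\<close>

definition griesmer_on :: "'n set \<Rightarrow> nat \<Rightarrow> nat \<Rightarrow> ('a::{field,finite} ^ 'n) set \<Rightarrow> bool" where
  "griesmer_on I k d V \<longleftrightarrow>
     vec.subspace V \<and> vec.dim V = k \<and> (\<forall>c\<in>V - {0}. d \<le> wt_on I c) \<and>
     card I \<le> griesmer_bound CARD('a) k d"

lemma wt_on_0 [simp]: "wt_on I 0 = 0"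
  by (simp add: wt_on_def)

lemma wt_on_eq_sum: "wt_on I c = (\<Sum>i\<in>I. of_bool (c $ i \<noteq> 0))"
  for c :: "'a::{field,finite} ^ 'n"
  by (simp add: wt_on_def of_bool_def sum.If_cases Int_def)

lemma wt_on_zeros_eq_sum: "wt_on (zeros I m) c = (\<Sum>i\<in>I. of_bool (m $ i = 0 \<and> c $ i \<noteq> 0))"
  for c :: "'a::{field,finite} ^ 'n"
  by (simp add: wt_on_def zeros_def of_bool_def sum.If_cases Int_def conj_assoc)

lemma card_zeros: "card I = wt_on I m + card (zeros I m)"
  for m :: "'a::{field,finite} ^ 'n"
proof -
  have "card I = card ({i \<in> I. m $ i \<noteq> 0} \<union> {i \<in> I. m $ i = 0})"
    by (rule arg_cong[of _ _ card]) auto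
  also have "\<dots> = wt_on I m + card (zeros I m)"
    unfolding wt_on_def zeros_def by (rule card_Un_disjoint) auto
  finally show ?thesis .
qed

lemma wt_on_zeros_shift [simp]: "wt_on (zeros I m) (x + l *s m) = wt_on (zeros I m) x"
  unfolding wt_on_def zeros_def by (rule arg_cong[of _ _ card]) auto

lemma affine_root_iff:
  fixes u v :: "'a::{field,finite}"
  assumes "v \<noteq> 0"
  shows "u + l * v = 0 \<longleftrightarrow> l = - u / v"
  using assms by (simp add: field_simps) (metis add_eq_0_iff)

text \<open>Count by coordinates: where \<open>m\<close> vanishes, the entry of \<open>x\<close> is
  repeated for every scalar; elsewhere exactly one scalar produces a zero.\<close>

lemma sum_wt_on_line:
  fixes x m :: "'a::{field,finite} ^ 'n"
  shows "(\<Sum>l\<in>UNIV. wt_on I (x + l *s m))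
    = CARD('a) * wt_on (zeros I m) x + (CARD('a) - 1) * wt_on I m"
proof -
  have coord: "(\<Sum>l\<in>UNIV. of_bool (u + l * v \<noteq> 0))
      = CARD('a) * of_bool (v = 0 \<and> u \<noteq> 0) + (CARD('a) - 1) * of_bool (v \<noteq> 0)"
    for u v :: 'a
  proof (cases "v = 0")
    case False
    have "{l. u + l * v \<noteq> 0} = UNIV - {- u / v}"
      using affine_root_iff[OF False] by auto
    with False show ?thesis
      by (simp add: of_bool_def sum.If_cases card_Diff_singleton)
  qed simp
  have "(\<Sum>l\<in>UNIV. wt_on I (x + l *s m))
      = (\<Sum>i\<in>I. \<Sum>l\<in>UNIV. of_bool (x $ i + l * m $ i \<noteq> 0))"
    unfolding wt_on_eq_sum by (subst sum.swap) simp
  then show ?thesis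
    unfolding coord
    by (simp only: sum.distrib sum_distrib_left wt_on_zeros_eq_sum) (simp add: wt_on_eq_sum sum_distrib_left)
qed

text \<open>The words \<open>x + l *s m\<close> are nonzero because \<open>m\<close> is outside
  \<open>W\<close>, so their weights sum to at least \<open>CARD('a) * d\<close>. Coordinates in the
  support of \<open>m\<close> account for \<open>(CARD('a) - 1) * d\<close>; the zeros of
  \<open>m\<close> must supply the rest.\<close>

lemma wt_on_residual_ge:
  fixes V :: "('a::{field,finite} ^ 'n) set"
  assumes V: "vec.subspace V" "\<And>c. c \<in> V \<Longrightarrow> c \<noteq> 0 \<Longrightarrow> d \<le> wt_on I c"
    and W: "vec.subspace W" "W \<subseteq> V" and m: "m \<in> V" "m \<notin> W" "wt_on I m = d"
    and x: "x \<in> W" "x \<noteq> 0"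
  shows "cdiv d CARD('a) \<le> wt_on (zeros I m) x"
proof -
  have "x + l *s m \<noteq> 0" for l
  proof
    assume *: "x + l *s m = 0"
    then have "l *s m = - x"
      by (metis add_eq_0_iff)
    then have lm: "l *s m \<in> W"
      using x(1) W(1) by (simp add: vec.subspace_neg)
    have "l \<noteq> 0"
      using * x(2) by auto
    have "inverse l *s (l *s m) \<in> W"
      by (rule vec.subspace_scale[OF W(1) lm])
    moreover have "inverse l *s (l *s m) = m"
      using \<open>l \<noteq> 0\<close> by (simp add: vec_eq_iff)
    ultimately show False
      using m(2) by metis
  qed
  moreover have "x + l *s m \<in> V" for l
    using V(1) W(2) m(1) x(1) by (intro vec.subspace_add vec.subspace_scale) auto
  ultimately have "(\<Sum>l\<in>(UNIV :: 'a set). d) \<le> (\<Sum>l\<in>UNIV. wt_on I (x + l *s m))"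
    using V(2) by (intro sum_mono) auto
  then have "CARD('a) * d \<le> CARD('a) * wt_on (zeros I m) x + (CARD('a) - 1) * d"
    unfolding sum_wt_on_line m(3) by simp
  moreover have "CARD('a) * d = (CARD('a) - 1) * d + d"
    by (cases "CARD('a)") auto
  ultimately show ?thesis
    by (simp add: cdiv_le_iff mult.commute)
qed

lemma min_word_exists:
  fixes V :: "('a::{field,finite} ^ 'n) set"
  assumes "vec.dim V \<noteq> 0"
  obtains m where "m \<in> V" "m \<noteq> 0" "\<And>c. c \<in> V \<Longrightarrow> c \<noteq> 0 \<Longrightarrow> wt_on I m \<le> wt_on I c"
proof -
  obtain c where "c \<in> V \<and> c \<noteq> 0"
    using assms by auto
  from ex_has_least_nat[of "\<lambda>c. c \<in> V \<and> c \<noteq> 0", OF this, of "wt_on I"] that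
  show ?thesis by blast
qed

text \<open>Induction through the residual code at a word of least weight. That weight may exceed
  \<open>d\<close>, which monotonicity of the bound absorbs.\<close>

lemma griesmer_bound_le_card:
  fixes V :: "('a::{field,finite} ^ 'n) set"
  assumes "vec.subspace V" "\<And>c. c \<in> V \<Longrightarrow> c \<noteq> 0 \<Longrightarrow> d \<le> wt_on I c" "vec.dim V = k"
  shows "griesmer_bound CARD('a) k d \<le> card I"
  using assms
proof (induction k arbitrary: V I d)
  case (Suc k)
  obtain m where m: "m \<in> V" "m \<noteq> 0" "\<And>c. c \<in> V \<Longrightarrow> c \<noteq> 0 \<Longrightarrow> wt_on I m \<le> wt_on I c"
    using min_word_exists[of V I] Suc.prems(3) by auto
  obtain W where W: "vec.subspace W" "W \<subseteq> V" "m \<notin> W" "vec.dim V = Suc (vec.dim W)"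
    using hyperplane_avoiding[of V "{}" m] Suc.prems(1) m by auto
  let ?d = "wt_on I m"
  have "griesmer_bound CARD('a) k (cdiv ?d CARD('a)) \<le> card (zeros I m)"
  proof (rule Suc.IH[OF W(1)])
    show "cdiv ?d CARD('a) \<le> wt_on (zeros I m) c" if "c \<in> W" "c \<noteq> 0" for c
      by (rule wt_on_residual_ge[OF Suc.prems(1) m(3) W(1,2) m(1) W(3) refl that])
    show "vec.dim W = k"
      using W(4) Suc.prems(3) by simp
  qed
  then have "griesmer_bound CARD('a) (Suc k) ?d \<le> card I"
    by (simp add: griesmer_bound_Suc card_zeros[of I m])
  moreover have "griesmer_bound CARD('a) (Suc k) d \<le> griesmer_bound CARD('a) (Suc k) ?d"
    using Suc.prems(2) m by (intro griesmer_bound_mono) auto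
  ultimately show ?case by linarith
qed simp

text \<open>\<open>griesmer_on\<close> only bounds weights from below. If the least weight exceeded
  \<open>d\<close>, the first Griesmer summand would grow and the others not fall, contradicting the
  bound on the length.\<close>

lemma griesmer_on_min_word:
  fixes V :: "('a::{field,finite} ^ 'n) set"
  assumes "griesmer_on I (Suc k) d V"
  obtains m where "m \<in> V" "m \<noteq> 0" "wt_on I m = d"
proof -
  have V: "vec.subspace V" "vec.dim V = Suc k" "\<And>c. c \<in> V \<Longrightarrow> c \<noteq> 0 \<Longrightarrow> d \<le> wt_on I c"
    "card I \<le> griesmer_bound CARD('a) (Suc k) d"
    using assms by (auto simp: griesmer_on_def)
  obtain m where m: "m \<in> V" "m \<noteq> 0" "\<And>c. c \<in> V \<Longrightarrow> c \<noteq> 0 \<Longrightarrow> wt_on I m \<le> wt_on I c"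
    using min_word_exists[of V I] V(2) by auto
  let ?d = "wt_on I m"
  have "d \<le> ?d"
    using V(3) m by blast
  have "griesmer_bound CARD('a) (Suc k) ?d \<le> griesmer_bound CARD('a) (Suc k) d"
    using griesmer_bound_le_card[OF V(1) m(3) V(2)] V(4) by simp
  moreover have "griesmer_bound CARD('a) k (cdiv d CARD('a)) \<le> griesmer_bound CARD('a) k (cdiv ?d CARD('a))"
    using \<open>d \<le> ?d\<close> by (intro griesmer_bound_mono cdiv_mono) auto
  ultimately have "?d = d"
    using \<open>d \<le> ?d\<close> by (simp add: griesmer_bound_Suc)
  with m that show ?thesis by blast
qed

text \<open>The complement \<open>W\<close> represents the quotient of \<open>V\<close> by the line
  of \<open>m\<close>. Passing to the zeros of \<open>m\<close> removes exactly \<open>d\<close>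
  coordinates, the first Griesmer summand.\<close>

lemma griesmer_on_residual:
  fixes V :: "('a::{field,finite} ^ 'n) set"
  assumes "griesmer_on I (Suc k) d V" "m \<in> V" "wt_on I m = d"
    and "vec.subspace W" "W \<subseteq> V" "m \<notin> W" "vec.dim V = Suc (vec.dim W)"
  shows "griesmer_on (zeros I m) k (cdiv d CARD('a)) W"
proof -
  have V: "vec.subspace V" "vec.dim V = Suc k" "\<And>c. c \<in> V \<Longrightarrow> c \<noteq> 0 \<Longrightarrow> d \<le> wt_on I c"
    "card I \<le> griesmer_bound CARD('a) (Suc k) d"
    using assms(1) by (auto simp: griesmer_on_def)
  have "cdiv d CARD('a) \<le> wt_on (zeros I m) c" if "c \<in> W" "c \<noteq> 0" for c
    by (rule wt_on_residual_ge[OF V(1,3) assms(4,5,2,6,3) that])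
  moreover have "card (zeros I m) \<le> griesmer_bound CARD('a) k (cdiv d CARD('a))"
    using V(4) assms(3) card_zeros[of I m] by (simp add: griesmer_bound_Suc)
  ultimately show ?thesis
    using V(2) assms by (auto simp: griesmer_on_def)
qed

lemma wt_on_minus_common_zeros: "x \<in> U \<Longrightarrow> wt_on (I - common_zeros I U) x = wt_on I x"
  unfolding wt_on_def common_zeros_def by (rule arg_cong[of _ _ card]) auto

text \<open>Deleting common zeros costs words of \<open>U\<close> no weight, and there are enough of
  them to pay for the last Griesmer summand.\<close>

lemma griesmer_on_shorten:
  fixes V :: "('a::{field,finite} ^ 'n) set"
  assumes "griesmer_on I (Suc k) d V" "vec.subspace U" "U \<subseteq> V" "vec.dim U = k"
    and "cdiv d (CARD('a) ^ k) \<le> card (common_zeros I U)"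
  shows "griesmer_on (I - common_zeros I U) k d U"
proof -
  have "card (I - common_zeros I U) = card I - card (common_zeros I U)"
    by (rule card_Diff_subset) (auto simp: common_zeros_def)
  with assms show ?thesis
    by (auto simp: griesmer_on_def wt_on_minus_common_zeros griesmer_bound_Suc_last)
qed

lemma common_zeros_span: "common_zeros I (vec.span S) = common_zeros I S"
  for S :: "('a::{field,finite} ^ 'n) set"
proof -
  have "vec.span S \<subseteq> {x. x $ i = 0}" if "\<forall>x\<in>S. x $ i = 0" for i
    using that by (intro vec.span_minimal) (auto simp: vec.subspace_def)
  then show ?thesis
    by (auto simp: common_zeros_def intro: vec.span_base)
qed

lemma common_zeros_span_insert:
  "common_zeros I (vec.span (insert t U)) = common_zeros (zeros I t) U"
  unfolding common_zeros_span by (auto simp: common_zeros_def zeros_def)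

lemma not_in_span_insert:
  fixes U :: "('a::field ^ 'n) set"
  assumes "vec.subspace U" "c \<notin> U" "y \<notin> vec.span (insert c U)"
  shows "c \<notin> vec.span (insert y U)"
  using assms vec.in_span_insert[of c y U] by (auto simp: vec.span_eq_iff[THEN iffD2])

section \<open>Points of maximal multiplicity\<close>

text \<open>Geometrically, the coordinates of the code are points of a projective space and the
  subcodes \<open>U\<close> below are points of maximal multiplicity; the lemma says that they are not
  contained in a hyperplane.\<close>

lemma max_point_avoiding:
  fixes V :: "('a::{field,finite} ^ 'n) set"
  assumes "griesmer_on I (Suc k) d V" "0 < d" "c \<in> V" "c \<noteq> 0"
  shows "\<exists>U. vec.subspace U \<and> U \<subseteq> V \<and> vec.dim U = k \<and> c \<notin> U \<and>
    cdiv d (CARD('a) ^ k) \<le> card (common_zeros I U)"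
  using assms
proof (induction k arbitrary: V I d c)
  case 0
  have "d \<le> wt_on I c"
    using 0 by (auto simp: griesmer_on_def)
  also have "\<dots> \<le> card I"
    unfolding wt_on_def by (rule card_mono) auto
  finally have "d \<le> card I" .
  with 0 show ?case
    by (intro exI[of _ "{0}"])
      (auto simp: common_zeros_def cdiv_le_iff vec.subspace_0 griesmer_on_def)
next
  case (Suc k)
  note V = Suc.prems(1)
  have sV: "vec.subspace V" and dV: "vec.dim V = Suc (Suc k)"
    using V by (auto simp: griesmer_on_def)
  have "\<exists>U\<^sub>0. vec.subspace U\<^sub>0 \<and> U\<^sub>0 \<subseteq> V \<and> vec.dim U\<^sub>0 = Suc k \<and>
    cdiv d (CARD('a) ^ Suc k) \<le> card (common_zeros I U\<^sub>0)"
  proof -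
    \<comment> \<open>First some maximal point, regardless of \<open>c\<close>: take one of the
      residual code at \<open>m\<close>, avoiding an arbitrary nonzero word, and adjoin
      \<open>m\<close>.\<close>
    obtain m where m: "m \<in> V" "m \<noteq> 0" "wt_on I m = d"
      using griesmer_on_min_word[OF V] .
    obtain W where W: "vec.subspace W" "W \<subseteq> V" "m \<notin> W" "vec.dim V = Suc (vec.dim W)"
      using hyperplane_avoiding[of V "{}" m] sV m by auto
    have res: "griesmer_on (zeros I m) (Suc k) (cdiv d CARD('a)) W"
      by (rule griesmer_on_residual[OF V m(1,3) W])
    obtain c' where "c' \<in> W" "c' \<noteq> 0"
      using griesmer_on_min_word[OF res] .
    then obtain U where U: "vec.subspace U" "U \<subseteq> W" "vec.dim U = k"
      "cdiv (cdiv d CARD('a)) (CARD('a) ^ k) \<le> card (common_zeros (zeros I m) U)"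
      using Suc.IH[OF res] cdiv_pos[OF _ Suc.prems(2), of "CARD('a)"] by auto
    have "vec.span (insert m U) \<subseteq> V"
      using U W m sV by (intro vec.span_minimal) auto
    moreover have "vec.dim (vec.span (insert m U)) = Suc k"
      using dim_span_insert[OF U(1), of m] U W by auto
    moreover have "cdiv d (CARD('a) ^ Suc k) \<le> card (common_zeros I (vec.span (insert m U)))"
      using U(4) by (simp add: common_zeros_span_insert cdiv_cdiv)
    ultimately show ?thesis
      using vec.subspace_span by blast
  qed
  then obtain U\<^sub>0 where U\<^sub>0: "vec.subspace U\<^sub>0" "U\<^sub>0 \<subseteq> V" "vec.dim U\<^sub>0 = Suc k"
    "cdiv d (CARD('a) ^ Suc k) \<le> card (common_zeros I U\<^sub>0)"
    by blast
  show ?case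
  proof (cases "c \<in> U\<^sub>0")
    case False
    with U\<^sub>0 show ?thesis by blast
  next
    case True
    \<comment> \<open>The point found contains \<open>c\<close>, so shorten there and find a maximal
      point \<open>W\<close> of the shortened code that misses \<open>c\<close>.\<close>
    let ?J = "I - common_zeros I U\<^sub>0"
    have "griesmer_on ?J (Suc k) d U\<^sub>0"
      by (rule griesmer_on_shorten[OF V U\<^sub>0])
    from Suc.IH[OF this Suc.prems(2) True Suc.prems(4)] obtain W where W:
      "vec.subspace W" "W \<subseteq> U\<^sub>0" "vec.dim W = k" "c \<notin> W"
      "cdiv d (CARD('a) ^ k) \<le> card (common_zeros ?J W)"
      by blast
    have "U\<^sub>0 \<noteq> V"
      using U\<^sub>0(3) dV by auto
    then obtain b where b: "b \<in> V" "b \<notin> U\<^sub>0"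
      using U\<^sub>0(2) by blast
    \<comment> \<open>Modulo \<open>W\<close> the code is a plane; the \<open>U l\<close> are all
      hyperplanes of \<open>V\<close> through \<open>W\<close> other than \<open>U\<^sub>0\<close>,
      which is spanned by \<open>W\<close> and \<open>c\<close>.\<close>
    define U where "U l = vec.span (insert (b + l *s c) W)" for l
    have bl: "b + l *s c \<notin> U\<^sub>0" for l
    proof
      assume "b + l *s c \<in> U\<^sub>0"
      then have "(b + l *s c) - l *s c \<in> U\<^sub>0"
        using U\<^sub>0(1) True by (intro vec.subspace_diff vec.subspace_scale)
      with b(2) show False by simp
    qed
    have U: "vec.subspace (U l)" "U l \<subseteq> V" "vec.dim (U l) = Suc k" "c \<notin> U l" for l
    proof -
      show "vec.subspace (U l)"
        by (simp add: U_def)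
      have "b + l *s c \<in> V"
        using sV b(1) Suc.prems(3) by (intro vec.subspace_add vec.subspace_scale)
      then show "U l \<subseteq> V"
        unfolding U_def using sV W(2) U\<^sub>0(2) by (intro vec.span_minimal) auto
      have "b + l *s c \<notin> W"
        using bl W(2) by blast
      then show "vec.dim (U l) = Suc k"
        unfolding U_def using dim_span_insert[OF W(1)] W(3) by simp
      have "vec.span (insert c W) \<subseteq> U\<^sub>0"
        using U\<^sub>0(1) W(2) True by (intro vec.span_minimal) auto
      then have "b + l *s c \<notin> vec.span (insert c W)"
        using bl by blast
      then show "c \<notin> U l"
        unfolding U_def by (rule not_in_span_insert[OF W(1,4)])
    qed
    have span_U\<^sub>0: "vec.span (insert c W) = U\<^sub>0"
      using W U\<^sub>0 True by (intro span_insert_eq) auto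
    \<comment> \<open>A coordinate vanishing on \<open>W\<close> but not on \<open>U\<^sub>0\<close>
      is nonzero at \<open>c\<close>, so some \<open>b + l *s c\<close> vanishes there.\<close>
    have "common_zeros ?J W \<subseteq> (\<Union>l. common_zeros I (U l))"
    proof
      fix i
      assume i: "i \<in> common_zeros ?J W"
      then have "i \<in> I" "i \<notin> common_zeros (zeros I c) W" "\<forall>x\<in>W. x $ i = 0"
        using span_U\<^sub>0 common_zeros_span_insert[of I c W] by (auto simp: common_zeros_def)
      then have "c $ i \<noteq> 0"
        by (auto simp: common_zeros_def zeros_def)
      then have "(b + (- b $ i / c $ i) *s c) $ i = 0"
        by simp
      then have "i \<in> common_zeros I (U (- b $ i / c $ i))"
        using \<open>i \<in> I\<close> \<open>\<forall>x\<in>W. x $ i = 0\<close>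
        unfolding U_def common_zeros_span by (auto simp: common_zeros_def)
      then show "i \<in> (\<Union>l. common_zeros I (U l))"
        by blast
    qed
    then have "card (common_zeros ?J W) \<le> card (\<Union>l. common_zeros I (U l))"
      by (intro card_mono) auto
    also have "\<dots> \<le> (\<Sum>l\<in>UNIV. card (common_zeros I (U l)))"
      by (rule card_UN_le) simp
    finally have le: "cdiv d (CARD('a) ^ k) \<le> (\<Sum>l\<in>UNIV. card (common_zeros I (U l)))"
      using W(5) by linarith
    \<comment> \<open>Pigeonhole over the \<open>CARD('a)\<close> scalars; nested rounding makes the
      average just large enough.\<close>
    have "\<exists>l. cdiv d (CARD('a) ^ Suc k) \<le> card (common_zeros I (U l))"
    proof (rule ccontr)
      assume "\<nexists>l. cdiv d (CARD('a) ^ Suc k) \<le> card (common_zeros I (U l))"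
      then have "\<not> cdiv d (CARD('a) ^ Suc k) \<le> card (common_zeros I (U l))" for l
        by blast
      then have "card (common_zeros I (U l)) \<le> cdiv d (CARD('a) ^ Suc k) - 1" for l
        by (metis One_nat_def Suc_leI Suc_pred gr_zeroI le_zero_eq less_Suc_eq_le linorder_not_le not_less_zero)
      then have "(\<Sum>l\<in>(UNIV::'a set). card (common_zeros I (U l)))
          \<le> (\<Sum>l\<in>(UNIV::'a set). cdiv d (CARD('a) ^ Suc k) - 1)"
        by (intro sum_mono)
      with le have "cdiv d (CARD('a) ^ k) \<le> (cdiv d (CARD('a) ^ Suc k) - 1) * CARD('a)"
        by (simp add: mult.commute)
      then have "cdiv (cdiv d (CARD('a) ^ k)) CARD('a) \<le> cdiv d (CARD('a) ^ Suc k) - 1"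
        by (simp only: cdiv_le_iff zero_less_card_finite)
      moreover have "cdiv (cdiv d (CARD('a) ^ k)) CARD('a) = cdiv d (CARD('a) ^ Suc k)"
        by (simp add: cdiv_cdiv mult.commute)
      moreover have "0 < cdiv d (CARD('a) ^ Suc k)"
        using Suc.prems(2) by (intro cdiv_pos) auto
      ultimately show False by linarith
    qed
    with U show ?thesis by blast
  qed
qed

text \<open>Represent the residual code at \<open>t\<close> by a hyperplane \<open>W\<close> through
  \<open>x\<close>, avoid \<open>x\<close> there, then adjoin \<open>t\<close>. Since
  \<open>t\<close> is outside \<open>W\<close>, \<open>x\<close> stays outside the enlarged
  subcode.\<close>

lemma max_point_through:
  fixes V :: "('a::{field,finite} ^ 'n) set"
  assumes "griesmer_on I (Suc (Suc k)) d V" "0 < d"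
    and "t \<in> V" "wt_on I t = d" "x \<in> V" "x \<noteq> 0" "t \<notin> vec.span {x}"
  obtains U where "vec.subspace U" "U \<subseteq> V" "vec.dim U = Suc k" "t \<in> U" "x \<notin> U"
    "cdiv d (CARD('a) ^ Suc k) \<le> card (common_zeros I U)"
proof -
  have sV: "vec.subspace V"
    using assms(1) by (simp add: griesmer_on_def)
  obtain W where W: "vec.subspace W" "x \<in> W" "W \<subseteq> V" "t \<notin> W" "vec.dim V = Suc (vec.dim W)"
    using hyperplane_avoiding[of V "{x}" t] sV assms(3,5,7) by auto
  have "griesmer_on (zeros I t) (Suc k) (cdiv d CARD('a)) W"
    by (rule griesmer_on_residual[OF assms(1,3,4) W(1,3,4,5)])
  then obtain U where U: "vec.subspace U" "U \<subseteq> W" "vec.dim U = k" "x \<notin> U"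
    "cdiv (cdiv d CARD('a)) (CARD('a) ^ k) \<le> card (common_zeros (zeros I t) U)"
    using max_point_avoiding[of "zeros I t" k "cdiv d CARD('a)" W x]
      cdiv_pos[OF _ assms(2), of "CARD('a)"] W(2) assms(6) by auto
  show ?thesis
  proof (rule that[of "vec.span (insert t U)"])
    show "vec.span (insert t U) \<subseteq> V"
      using sV U(2) W(3) assms(3) by (intro vec.span_minimal) auto
    show "vec.dim (vec.span (insert t U)) = Suc k"
      using dim_span_insert[OF U(1), of t] U W by auto
    have "vec.span (insert x U) \<subseteq> W"
      using W(1,2) U(2) by (intro vec.span_minimal) auto
    then show "x \<notin> vec.span (insert t U)"
      using W(4) by (intro not_in_span_insert[OF U(1,4)]) auto
    show "cdiv d (CARD('a) ^ Suc k) \<le> card (common_zeros I (vec.span (insert t U)))"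
      using U(5) by (simp add: common_zeros_span_insert cdiv_cdiv)
  qed (auto intro: vec.span_base)
qed

text \<open>Choose \<open>m\<close> of least weight in the residual code at \<open>n\<close>. As
  \<open>CARD('a)\<close> divides \<open>d\<close>, nothing is lost in rounding: the weights of
  \<open>m + s *s n\<close> average exactly \<open>d\<close>, and none is smaller.\<close>

lemma constant_weight_plane:
  fixes V :: "('a::{field,finite} ^ 'n) set"
  assumes "griesmer_on I (Suc (Suc k)) d V" "CARD('a) dvd d"
  obtains m n where "m \<in> V" "n \<in> V" "n \<noteq> 0" "m \<notin> vec.span {n}" "wt_on I n = d"
    "\<And>s. wt_on I (m + s *s n) = d"
proof -
  have V: "vec.subspace V" "\<And>c. c \<in> V \<Longrightarrow> c \<noteq> 0 \<Longrightarrow> d \<le> wt_on I c"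
    using assms(1) by (auto simp: griesmer_on_def)
  obtain n where n: "n \<in> V" "n \<noteq> 0" "wt_on I n = d"
    using griesmer_on_min_word[OF assms(1)] .
  obtain W where W: "vec.subspace W" "W \<subseteq> V" "n \<notin> W" "vec.dim V = Suc (vec.dim W)"
    using hyperplane_avoiding[of V "{}" n] V(1) n by auto
  have "griesmer_on (zeros I n) (Suc k) (cdiv d CARD('a)) W"
    by (rule griesmer_on_residual[OF assms(1) n(1,3) W])
  then obtain m where m: "m \<in> W" "m \<noteq> 0" "wt_on (zeros I n) m = cdiv d CARD('a)"
    by (rule griesmer_on_min_word)
  have indep: "m \<notin> vec.span {n}"
  proof
    assume "m \<in> vec.span {n}"
    then have "n \<in> vec.span {m}"
      using vec.in_span_insert[of m n "{}"] m(2) by simp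
    moreover have "vec.span {m} \<subseteq> W"
      using m(1) W(1) by (intro vec.span_minimal) auto
    ultimately show False using W(3) by blast
  qed
  have ge: "d \<le> wt_on I (m + s *s n)" for s
  proof (rule V(2))
    show "m + s *s n \<in> V"
      using V(1) m(1) n(1) W(2) by (intro vec.subspace_add vec.subspace_scale) auto
    show "m + s *s n \<noteq> 0"
    proof
      assume "m + s *s n = 0"
      then have "m = (- s) *s n"
        by (simp add: eq_neg_iff_add_eq_0)
      moreover have "(- s) *s n \<in> vec.span {n}"
        by (intro vec.span_scale vec.span_base) simp
      ultimately have "m \<in> vec.span {n}"
        by (simp only:)
      with indep show False ..
    qed
  qed
  have "(\<Sum>s\<in>UNIV. wt_on I (m + s *s n)) = CARD('a) * cdiv d CARD('a) + (CARD('a) - 1) * d"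
    by (simp add: sum_wt_on_line m(3) n(3))
  also have "CARD('a) * cdiv d CARD('a) = d"
    using assms(2) by (auto simp: cdiv_mult_self)
  also have "d + (CARD('a) - 1) * d = (\<Sum>s\<in>(UNIV :: 'a set). d)"
    by (cases "CARD('a)") auto
  finally have "(\<Sum>s\<in>(UNIV :: 'a set). d) = (\<Sum>s\<in>UNIV. wt_on I (m + s *s n))"
    by simp
  then have "wt_on I (m + s *s n) = d" for s
    using sum_mono_inv[of "\<lambda>_. d" UNIV "\<lambda>s. wt_on I (m + s *s n)" s] ge by simp
  with that[OF _ n(1,2) indep n(3)] m(1) W(2) show ?thesis by blast
qed

text \<open>A coordinate on which \<open>m\<close> and \<open>n\<close> do not both vanish is a zero of exactly one of the \<open>q + 1\<close>
  directions of the plane spanned by \<open>m\<close> and \<open>n\<close>.\<close>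

lemma wt_on_plane:
  fixes c m n :: "'a::{field,finite} ^ 'n"
  shows "wt_on I (c + a *s m + b *s n) + CARD('a) * wt_on (zeros (zeros I m) n) c
    = (\<Sum>s\<in>UNIV. wt_on (zeros I (m + s *s n)) (c + (b - s * a) *s n)) + wt_on (zeros I n) (c + a *s m)"
proof -
  have zz: "wt_on (zeros (zeros I m) n) c = (\<Sum>i\<in>I. of_bool (m $ i = 0 \<and> n $ i = 0 \<and> c $ i \<noteq> 0))"
    by (simp add: wt_on_def zeros_def of_bool_def sum.If_cases Int_def conj_assoc)
  \<comment> \<open>Modulo \<open>m + s *s n\<close>, the word \<open>c + a *s m + b *s n\<close>
    equals \<open>c + (b - s * a) *s n\<close>. Where \<open>m\<close> and \<open>n\<close> both
    vanish, all \<open>CARD('a) + 1\<close> directions count the coordinate; the extra term on the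
    left corrects this.\<close>
  have coord: "of_bool (w + a * u + b * v \<noteq> 0) + CARD('a) * of_bool (u = 0 \<and> v = 0 \<and> w \<noteq> 0)
      = (\<Sum>s\<in>UNIV. of_bool (u + s * v = 0 \<and> w + (b - s * a) * v \<noteq> 0))
        + (of_bool (v = 0 \<and> w + a * u \<noteq> 0) :: nat)" for u v w :: 'a
  proof (cases "v = 0")
    case False
    have "of_bool (u + s * v = 0 \<and> w + (b - s * a) * v \<noteq> 0)
        = (if s = - u / v then of_bool (w + a * u + b * v \<noteq> 0) else 0 :: nat)" for s
    proof (cases "s = - u / v")
      case True
      then have sv: "s * v = - u"
        using False by simp
      then have "w + (b - s * a) * v = w + a * u + b * v"
        by (simp add: algebra_simps)
      with sv True show ?thesis
        by (simp only:) simp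
    qed (use affine_root_iff[OF False] in simp)
    with False show ?thesis
      by simp
  qed auto
  have "wt_on I (c + a *s m + b *s n) + CARD('a) * wt_on (zeros (zeros I m) n) c
      = (\<Sum>i\<in>I. of_bool (c $ i + a * m $ i + b * n $ i \<noteq> 0)
          + CARD('a) * of_bool (m $ i = 0 \<and> n $ i = 0 \<and> c $ i \<noteq> 0))"
    by (simp only: zz wt_on_eq_sum[of I] sum_distrib_left sum.distrib vector_add_component
        vector_smult_component)
  also have "\<dots> = (\<Sum>i\<in>I. (\<Sum>s\<in>UNIV. of_bool (m $ i + s * n $ i = 0 \<and> c $ i + (b - s * a) * n $ i \<noteq> 0))
        + of_bool (n $ i = 0 \<and> c $ i + a * m $ i \<noteq> 0))"
    unfolding coord ..
  also have "\<dots> = (\<Sum>s\<in>UNIV. \<Sum>i\<in>I. of_bool (m $ i + s * n $ i = 0 \<and> c $ i + (b - s * a) * n $ i \<noteq> 0))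
        + (\<Sum>i\<in>I. of_bool (n $ i = 0 \<and> c $ i + a * m $ i \<noteq> 0))"
    unfolding sum.distrib by (subst sum.swap) (rule refl)
  finally show ?thesis
    by (simp only: wt_on_zeros_eq_sum[of I] vector_add_component vector_smult_component)
qed

section \<open>Divisibility\<close>

text \<open>Translation by \<open>1\<close> permutes the field, so the sum of all elements does not
  change when each grows by \<open>1\<close>.\<close>

lemma of_nat_card_field: "of_nat CARD('a) = (0 :: 'a::{field,finite})"
proof -
  have "(\<Sum>x\<in>UNIV. x + 1) = (\<Sum>x\<in>UNIV. x :: 'a)"
    by (rule sum.reindex_bij_witness[of _ "\<lambda>x. x - 1" "\<lambda>x. x + 1"]) auto
  then show ?thesis
    by (simp add: sum.distrib)
qed

lemma of_nat_eq_0_iff_prime_dvd: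
  assumes "prime p" "CARD('a::{field,finite}) = p ^ f"
  shows "of_nat n = (0 :: 'a) \<longleftrightarrow> p dvd n"
proof -
  have "of_nat p ^ f = (0 :: 'a)"
    using of_nat_card_field[where 'a='a] assms(2) by simp
  then have "CHAR('a) dvd p"
    by (simp flip: of_nat_eq_0_iff_char_dvd)
  moreover have "CHAR('a) \<noteq> 1"
    by simp
  ultimately have "CHAR('a) = p"
    using assms(1) by (auto simp: prime_nat_iff)
  then show ?thesis
    by (simp add: of_nat_eq_0_iff_char_dvd)
qed

text \<open>After division by \<open>p ^ e\<close>, divisibility by one more \<open>p\<close> means
  vanishing in the field, where the quotient is a sum of line functions.\<close>

lemma dvd_if_dvd_on_all_slopes:
  fixes w :: "'a::{field,finite} \<Rightarrow> 'a \<Rightarrow> nat" and R :: "'a \<Rightarrow> 'a \<Rightarrow> nat" and S :: "'a \<Rightarrow> nat"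
  assumes p: "prime p" "CARD('a) = p ^ f"
    and w: "\<And>x y. w x y + K = (\<Sum>s\<in>UNIV. R s (y - s * x)) + S x"
    and R: "\<And>s z. p ^ e dvd R s z" and S: "\<And>x. p ^ e dvd S x"
    and lines: "\<And>s. \<exists>\<beta>. \<forall>x. p ^ Suc e dvd w x (s * x + \<beta>)"
  shows "p ^ Suc e dvd w x y"
proof -
  note zero_iff = of_nat_eq_0_iff_prime_dvd[OF p]
  have pe: "p ^ e \<noteq> 0"
    using p(1) by auto
  obtain r where r: "\<And>s z. R s z = p ^ e * r s z"
    using R unfolding dvd_def by metis
  obtain \<sigma> where \<sigma>: "\<And>x. S x = p ^ e * \<sigma> x"
    using S unfolding dvd_def by metis
  have sum_dvd: "p ^ e dvd w x y + K" for x y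
    unfolding w using R S by (intro dvd_add dvd_sum)
  \<comment> \<open>One point of one given line suffices: there \<open>w\<close> is divisible, hence
    so is \<open>K\<close>, and then \<open>w\<close> is divisible by \<open>p ^ e\<close>
    everywhere.\<close>
  have "p ^ e dvd K"
  proof -
    obtain \<beta> where "p ^ Suc e dvd w 0 \<beta>"
      using lines[of 0] by auto
    then have "p ^ e dvd w 0 \<beta>"
      by (rule power_le_dvd) simp
    then show ?thesis
      using sum_dvd[of 0 \<beta>] by (simp add: dvd_add_right_iff)
  qed
  then obtain \<kappa> where \<kappa>: "K = p ^ e * \<kappa>" ..
  have "p ^ e dvd w x y" for x y
    using sum_dvd[of x y] \<open>p ^ e dvd K\<close> by (simp add: dvd_add_left_iff)
  then obtain v where v: "\<And>x y. w x y = p ^ e * v x y"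
    unfolding dvd_def by metis
  have v_sum: "v x y + \<kappa> = (\<Sum>s\<in>UNIV. r s (y - s * x)) + \<sigma> x" for x y
  proof -
    have "p ^ e * (v x y + \<kappa>) = p ^ e * ((\<Sum>s\<in>UNIV. r s (y - s * x)) + \<sigma> x)"
      using w[of x y] by (simp add: v \<kappa> r \<sigma> sum_distrib_left distrib_left)
    with pe show ?thesis
      by (metis mult_left_cancel)
  qed
  define A where "A s z = (of_nat (r s z) :: 'a)" for s z
  define B where "B x = (of_nat (\<sigma> x) - of_nat \<kappa> :: 'a)" for x
  have v_field: "of_nat (v x y) = (\<Sum>s\<in>UNIV. A s (y - s * x)) + B x" for x y
  proof -
    have "of_nat (v x y) + of_nat \<kappa> = (\<Sum>s\<in>UNIV. A s (y - s * x)) + (of_nat (\<sigma> x) :: 'a)"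
      using arg_cong[OF v_sum[of x y], of "of_nat :: nat \<Rightarrow> 'a"] by (simp add: A_def)
    then show ?thesis
      by (simp add: B_def algebra_simps)
  qed
  have dvd_iff: "p ^ Suc e dvd w x y \<longleftrightarrow> of_nat (v x y) = (0 :: 'a)" for x y
    using prime_gt_0_nat[OF p(1)] by (simp add: v zero_iff mult.commute)
  have "(\<Sum>s\<in>UNIV. A s (y - s * x)) + B x = 0"
  proof (rule sum_of_line_functions_zero[where A = A and B = B])
    show "\<exists>\<beta>. \<forall>x. (\<Sum>t\<in>UNIV. A t (s * x + \<beta> - t * x)) + B x = 0" for s
      using lines[of s] unfolding dvd_iff v_field .
  qed
  then show ?thesis
    unfolding dvd_iff v_field .
qed

lemma griesmer_on_dvd_wt:
  fixes V :: "('a::{field,finite} ^ 'n) set"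
  assumes p: "prime p" "CARD('a) = p ^ f"
    and "griesmer_on I k d V" "0 < d" "CARD('a) ^ e dvd d" "c \<in> V"
  shows "p ^ e dvd wt_on I c"
  using assms(3-)
proof (induction k arbitrary: V I d e c)
  case 0
  then show ?case
    by (auto simp: griesmer_on_def)
next
  case (Suc k)
  note V = Suc.prems(1) and c = Suc.prems(4)
  have sV: "vec.subspace V" and dV: "vec.dim V = Suc k"
    using V by (auto simp: griesmer_on_def)
  have "f \<noteq> 0"
    using p(2) card_field_ge_2[where 'a='a] by (cases f) auto
  then have "p dvd CARD('a)"
    using p(2) by simp
  then have ped: "p ^ e dvd d"
    using Suc.prems(3) by (meson dvd_power_same dvd_trans)
  show ?case
  proof (cases "k = 0 \<or> e = 0 \<or> c = 0")
    case True
    \<comment> \<open>In dimension one the length is at most \<open>d\<close>, so every nonzero word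
      has weight exactly \<open>d\<close>.\<close>
    moreover have "wt_on I c = d" if "k = 0" "c \<noteq> 0"
    proof -
      have "d \<le> wt_on I c"
        using V c that(2) by (auto simp: griesmer_on_def)
      moreover have "wt_on I c \<le> card I"
        unfolding wt_on_def by (rule card_mono) auto
      moreover have "card I \<le> d"
        using V that(1) by (simp add: griesmer_on_def griesmer_bound_Suc)
      ultimately show ?thesis by simp
    qed
    ultimately show ?thesis
      using ped by (cases "c = 0") auto
  next
    case False
    then obtain j e' where k: "k = Suc j" and e: "e = Suc e'"
      by (metis not0_implies_Suc)
    define d' where "d' = cdiv d CARD('a)"
    have d: "d = CARD('a) * d'"
      using Suc.prems(3) unfolding e by (auto simp: d'_def cdiv_mult_self mult.assoc)
    have "CARD('a) ^ e' dvd d'"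
      using Suc.prems(3) unfolding d e by simp
    have "0 < d'"
      using Suc.prems(2) d by (cases d') auto
    \<comment> \<open>Shifting \<open>x\<close> by a multiple of \<open>t\<close> moves it into a
      complement of \<open>t\<close> without changing its entries on the zeros of
      \<open>t\<close>.\<close>
    have residual: "p ^ e' dvd wt_on (zeros I t) x"
      if t: "t \<in> V" "t \<noteq> 0" "wt_on I t = d" and x: "x \<in> V" for t x
    proof -
      obtain W where W: "vec.subspace W" "W \<subseteq> V" "t \<notin> W" "vec.dim V = Suc (vec.dim W)"
        using hyperplane_avoiding[of V "{}" t] sV t by auto
      obtain l where "x + l *s t \<in> W"
        by (rule hyperplane_shift[OF W(1) sV W(2,4) t(1) W(3) x])
      from Suc.IH[OF griesmer_on_residual[OF V t(1,3) W, folded d'_def] \<open>0 < d'\<close> \<open>CARD('a) ^ e' dvd d'\<close> this]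
      show ?thesis by simp
    qed
    obtain m n where mn: "m \<in> V" "n \<in> V" "n \<noteq> 0" "m \<notin> vec.span {n}" "wt_on I n = d"
      "\<And>s. wt_on I (m + s *s n) = d"
      using constant_weight_plane[OF V[unfolded k]] d by auto
    have t: "m + s *s n \<in> V" "m + s *s n \<notin> vec.span {n}" for s
    proof -
      show "m + s *s n \<in> V"
        using sV mn by (intro vec.subspace_add vec.subspace_scale)
      show "m + s *s n \<notin> vec.span {n}"
      proof
        assume "m + s *s n \<in> vec.span {n}"
        moreover have "s *s n \<in> vec.span {n}"
          by (intro vec.span_scale vec.span_base) simp
        ultimately have "(m + s *s n) - s *s n \<in> vec.span {n}"
          by (rule vec.span_diff)
        with mn(4) show False by simp
      qed
    qed
    have t0: "m + s *s n \<noteq> 0" for s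
      using t(2)[of s] vec.span_zero by metis
    \<comment> \<open>In the coordinates \<open>(a, b)\<close>, the direction
      \<open>m + s *s n\<close> has slope \<open>s\<close> and \<open>n\<close> is vertical; the
      goal is the value at the origin.\<close>
    define w where "w a b = wt_on I (c + a *s m + b *s n)" for a b
    have "p ^ Suc e' dvd w 0 0"
    proof (rule dvd_if_dvd_on_all_slopes[OF p, where w = w
          and K = "CARD('a) * wt_on (zeros (zeros I m) n) c"
          and R = "\<lambda>s z. wt_on (zeros I (m + s *s n)) (c + z *s n)"
          and S = "\<lambda>a. wt_on (zeros I n) (c + a *s m)"])
      show "w a b + CARD('a) * wt_on (zeros (zeros I m) n) c
        = (\<Sum>s\<in>UNIV. wt_on (zeros I (m + s *s n)) (c + (b - s * a) *s n)) + wt_on (zeros I n) (c + a *s m)"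
        for a b
        unfolding w_def by (rule wt_on_plane)
      show "p ^ e' dvd wt_on (zeros I (m + s *s n)) (c + z *s n)" for s z
        by (intro residual t t0 mn(6) vec.subspace_add[OF sV] vec.subspace_scale[OF sV] c mn(2))
      show "p ^ e' dvd wt_on (zeros I n) (c + a *s m)" for a
        by (intro residual mn(1,2,3,5) vec.subspace_add[OF sV] vec.subspace_scale[OF sV] c)
      show "\<exists>\<beta>. \<forall>a. p ^ Suc e' dvd w a (s * a + \<beta>)" for s
      proof -
        \<comment> \<open>\<open>U\<close> contains the direction of slope \<open>s\<close> but not
          the vertical one, so a vertical shift of \<open>c\<close> by some \<open>\<beta>\<close>
          enters \<open>U\<close>, and then the whole line of slope \<open>s\<close> through it
          does.\<close>
        obtain U where U: "vec.subspace U" "U \<subseteq> V" "vec.dim U = k" "m + s *s n \<in> U" "n \<notin> U"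
          "cdiv d (CARD('a) ^ k) \<le> card (common_zeros I U)"
          using max_point_through[OF V[unfolded k] Suc.prems(2) t(1) mn(6) mn(2,3) t(2)] k by metis
        have "vec.dim V = Suc (vec.dim U)"
          using dV U(3) by simp
        then obtain \<beta> where \<beta>: "c + \<beta> *s n \<in> U"
          by (rule hyperplane_shift[OF U(1) sV U(2) _ mn(2) U(5) c])
        have "p ^ e dvd w a (s * a + \<beta>)" for a
        proof -
          have "c + a *s m + (s * a + \<beta>) *s n = (c + \<beta> *s n) + a *s (m + s *s n)"
            by (simp add: vec_eq_iff algebra_simps)
          then have "c + a *s m + (s * a + \<beta>) *s n \<in> U"
            using \<beta> U(1,4) by (simp only: vec.subspace_add vec.subspace_scale)
          moreover have "griesmer_on (I - common_zeros I U) k d U"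
            by (rule griesmer_on_shorten[OF V U(1,2,3,6)])
          ultimately show ?thesis
            using Suc.IH[OF _ Suc.prems(2,3)] by (metis w_def wt_on_minus_common_zeros)
        qed
        then show ?thesis
          unfolding e by blast
      qed
    qed
    then show ?thesis
      by (simp add: w_def e)
  qed
qed

theorem theorem1p7:
  fixes p f q k d e :: nat
    and C :: "('a::{field,finite} ^ 'n) set"
  assumes "prime p" and "f \<ge> 1" and "q = p ^ f"
    and "k \<ge> 1" and "d \<ge> 1"
    and "griesmer_code q k d C"
    and "full_length C"
    and "q ^ e dvd d"
  shows "\<forall>c\<in>C. p ^ e dvd wt c"
proof
  fix c
  assume "c \<in> C"
  have C: "CARD('a) = q" "CARD('n) = griesmer_bound q k d" "vec.subspace C" "vec.dim C = k"
    "min_weight C = d"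
    using assms(6) by (auto simp: griesmer_code_def linear_code_def)
  have wt: "wt_on UNIV = (wt :: 'a ^ 'n \<Rightarrow> nat)"
    by (simp add: fun_eq_iff wt_on_def wt_def)
  have "d \<le> wt x" if "x \<in> C" "x \<noteq> 0" for x
    using that unfolding C(5)[symmetric] min_weight_def by (intro Min_le) auto
  then have "griesmer_on UNIV k d C"
    using C by (auto simp: griesmer_on_def wt)
  then have "p ^ e dvd wt_on UNIV c"
    using assms \<open>c \<in> C\<close> C(1) by (intro griesmer_on_dvd_wt) auto
  then show "p ^ e dvd wt c"
    by (simp add: wt)
qed

end
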